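(* Let $G$ be a chordal graph with no isolated vertices and let $S$ be an $S(G)$-set. Then $\gamma_t(G)=2\gamma(G)$ if and only if $S$ is a packing and a dominating set of $G$.
   Context: All graphs are finite, simple and have nonempty vertex set. $N(v)$ is the set of vertices adjacent to $v$, $N[v]=N(v)\cup\{v\}$, and for $S\subseteq V(G)$, $N(S)=\bigcup_{v\in S}N(v)$ and $N[S]=N(S)\cup S$. Domination: $S\subseteq V(G)$ is a dominating set if $N[S]=V(G)$; $\gamma(G)$ is the minimum cardinality of a dominating set. If $G$ has no isolated vertices, $S$ is a total dominating set if $N(S)=V(G)$, and $\gamma_t(G)$ is the minimum cardinality of a total dominating set. A set $S\subseteq V(G)$ is a packing if $N[u]\cap N[v]=\emptyset$ for all distinct $u,v\in S$. Special vertices: two vertices $u,v$ are true twins if $N[u]=N[v]$. For each vertex $v$, $N[v]$ is partitioned into $T(v)$, consisting of $v$ and all its true twins; $D(v)=\{u\in N(v): N[u]\subsetneq N[v]\}$; and $M(v)=\{u\in N(v): u \text{ has a neighbor } w \text{ with } w\notin N[v]\}$. A non-isolated vertex $v$ is special if there is no $u\in M(v)$ with $D(v)\subseteq N(u)$; isolated vertices are declared not special. True twins of special vertices are special. An $S(G)$-set is a set obtained by choosing exactly one vertex from each class of the partition of the set of special vertices of $G$ under the true twin equivalence relation ($N[u]=N[v]$). A graph is chordal if it has no induced cycle of length at least 4. *)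

theory Defs
  imports "Graph_Theory.Pair_Digraph"
begin

text \<open>
  Finite simple graphs are the loop-free symmetric digraphs of \<^locale>\<open>pair_graph\<close>: an edge
  \<open>uv\<close> is the pair of arcs \<open>(u, v)\<close> and \<open>(v, u)\<close>. That locale admits the graph without
  vertices, so nonemptiness of the vertex set is a separate hypothesis.
\<close>

definition nbhd :: "'a pair_pre_digraph \<Rightarrow> 'a \<Rightarrow> 'a set" where
  "nbhd G v = {u. (v, u) \<in> parcs G}"

definition closed_nbhd :: "'a pair_pre_digraph \<Rightarrow> 'a \<Rightarrow> 'a set" where
  "closed_nbhd G v = nbhd G v \<union> {v}"

definition set_nbhd :: "'a pair_pre_digraph \<Rightarrow> 'a set \<Rightarrow> 'a set" where
  "set_nbhd G S = (\<Union>v\<in>S. nbhd G v)"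

definition closed_set_nbhd :: "'a pair_pre_digraph \<Rightarrow> 'a set \<Rightarrow> 'a set" where
  "closed_set_nbhd G S = set_nbhd G S \<union> S"

definition isolated :: "'a pair_pre_digraph \<Rightarrow> 'a \<Rightarrow> bool" where
  "isolated G v \<longleftrightarrow> v \<in> pverts G \<and> nbhd G v = {}"


definition dominating_set :: "'a pair_pre_digraph \<Rightarrow> 'a set \<Rightarrow> bool" where
  "dominating_set G S \<longleftrightarrow> S \<subseteq> pverts G \<and> closed_set_nbhd G S = pverts G"

definition domination_number :: "'a pair_pre_digraph \<Rightarrow> nat" where
  "domination_number G = (LEAST k. \<exists>S. dominating_set G S \<and> card S = k)"

definition total_dominating_set :: "'a pair_pre_digraph \<Rightarrow> 'a set \<Rightarrow> bool" where
  "total_dominating_set G S \<longleftrightarrow> S \<subseteq> pverts G \<and> set_nbhd G S = pverts G"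

text \<open>Meaningful only for graphs without isolated vertices; otherwise no total dominating set
  exists and the value is unspecified.\<close>
definition total_domination_number :: "'a pair_pre_digraph \<Rightarrow> nat" where
  "total_domination_number G = (LEAST k. \<exists>S. total_dominating_set G S \<and> card S = k)"

definition packing :: "'a pair_pre_digraph \<Rightarrow> 'a set \<Rightarrow> bool" where
  "packing G S \<longleftrightarrow> S \<subseteq> pverts G \<and>
     (\<forall>u\<in>S. \<forall>v\<in>S. u \<noteq> v \<longrightarrow> closed_nbhd G u \<inter> closed_nbhd G v = {})"


definition true_twins :: "'a pair_pre_digraph \<Rightarrow> 'a \<Rightarrow> 'a \<Rightarrow> bool" where
  "true_twins G u v \<longleftrightarrow> closed_nbhd G u = closed_nbhd G v"

text \<open>Together with the true twins of \<open>v\<close>, these two sets partition the closed neighbourhood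
  of \<open>v\<close>.\<close>
definition D_set :: "'a pair_pre_digraph \<Rightarrow> 'a \<Rightarrow> 'a set" where
  "D_set G v = {u \<in> nbhd G v. closed_nbhd G u \<subset> closed_nbhd G v}"

definition M_set :: "'a pair_pre_digraph \<Rightarrow> 'a \<Rightarrow> 'a set" where
  "M_set G v = {u \<in> nbhd G v. \<exists>w \<in> nbhd G u. w \<notin> closed_nbhd G v}"

definition special :: "'a pair_pre_digraph \<Rightarrow> 'a \<Rightarrow> bool" where
  "special G v \<longleftrightarrow> v \<in> pverts G \<and> \<not> isolated G v \<and>
     \<not> (\<exists>u \<in> M_set G v. D_set G v \<subseteq> nbhd G u)"

definition special_vertices :: "'a pair_pre_digraph \<Rightarrow> 'a set" where
  "special_vertices G = {v. special G v}"

definition special_twin_rel :: "'a pair_pre_digraph \<Rightarrow> 'a rel" where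
  "special_twin_rel G =
     {(u, v). u \<in> special_vertices G \<and> v \<in> special_vertices G \<and> true_twins G u v}"

text \<open>An \<open>S(G)\<close>-set: a transversal of the true-twin classes of special vertices.\<close>
definition S_set :: "'a pair_pre_digraph \<Rightarrow> 'a set \<Rightarrow> bool" where
  "S_set G S \<longleftrightarrow> S \<subseteq> special_vertices G \<and>
     (\<forall>C \<in> special_vertices G // special_twin_rel G. \<exists>!v. v \<in> S \<inter> C)"


text \<open>The vertices of an induced cycle are listed in cyclic order. The equivalence requires the
  edges of the cycle to be present and all chords to be absent. The library's notion of cycle is
  not used here because in a symmetric digraph it admits \<open>u, v, u\<close> and does not exclude
  chords.\<close>
definition induced_cycle :: "'a pair_pre_digraph \<Rightarrow> 'a list \<Rightarrow> bool" where
  "induced_cycle G vs \<longleftrightarrow> 3 \<le> length vs \<and> distinct vs \<and> set vs \<subseteq> pverts G \<and>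
     (\<forall>i < length vs. \<forall>j < length vs.
        (vs ! i, vs ! j) \<in> parcs G \<longleftrightarrow>
          j = Suc i mod length vs \<or> i = Suc j mod length vs)"

definition chordal :: "'a pair_pre_digraph \<Rightarrow> bool" where
  "chordal G \<longleftrightarrow> \<not> (\<exists>vs. induced_cycle G vs \<and> 4 \<le> length vs)"

end

theory Submission
  imports Defs
begin

text \<open>
  If \<open>S\<close> is a packing and a dominating set, then \<open>\<gamma>(G) = |S|\<close>, and a total dominating set meets
  the closed neighbourhood of a special vertex in at least two vertices, so \<open>\<gamma>\<^sub>t(G) \<ge> 2|S|\<close>.

  Conversely, let \<open>\<gamma>\<^sub>t(G) = 2\<gamma>(G)\<close> and let \<open>D\<close> be a minimum dominating set. Two vertices of \<open>D\<close>
  with meeting closed neighbourhoods would allow a total dominating set with fewer than \<open>2|D|\<close>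
  vertices, so \<open>D\<close> is a packing. Chordality gives, for distinct \<open>v, a \<in> D\<close>, a neighbour
  \<open>p a\<close> of \<open>a\<close> adjacent to all those neighbours of \<open>v\<close> that have a neighbour in \<open>N(a)\<close>. If
  \<open>v \<in> D\<close> were not special, as witnessed by \<open>u \<in> M(v)\<close>, then \<open>u\<close> together with all \<open>a\<close> and \<open>p a\<close>
  for \<open>a \<in> D - {v}\<close> would be a total dominating set with fewer than \<open>2|D|\<close> vertices. So \<open>D\<close>
  consists of special vertices, and then every special vertex is a true twin of a vertex of \<open>D\<close>.
\<close>

section \<open>Neighbourhoods and minimum dominating sets\<close>

lemma self_in_closed_nbhd [simp]: "v \<in> closed_nbhd G v"
  by (simp add: closed_nbhd_def)

lemma domination_number_le: "dominating_set G S \<Longrightarrow> domination_number G \<le> card S"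
  unfolding domination_number_def by (rule Least_le) blast

lemma total_domination_number_le:
  "total_dominating_set G S \<Longrightarrow> total_domination_number G \<le> card S"
  unfolding total_domination_number_def by (rule Least_le) blast

context pair_graph
begin

lemma nbhd_sym: "u \<in> nbhd G v \<longleftrightarrow> v \<in> nbhd G u"
  unfolding nbhd_def using arcs_symmetric by blast

lemma nbhd_irrefl [simp]: "v \<notin> nbhd G v"
  unfolding nbhd_def using pair_no_loops[of "(v, v)"] by auto

lemma nbhd_in_verts: "u \<in> nbhd G v \<Longrightarrow> u \<in> pverts G"
  unfolding nbhd_def using in_arcsD2 by auto

lemma finite_nbhd: "finite (nbhd G v)"
  using finite_subset[OF _ pair_finite_verts] nbhd_in_verts by blast

lemma closed_nbhd_sym: "u \<in> closed_nbhd G v \<longleftrightarrow> v \<in> closed_nbhd G u"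
  using nbhd_sym by (auto simp: closed_nbhd_def)

lemma dominating_set_iff:
  "dominating_set G S \<longleftrightarrow> S \<subseteq> pverts G \<and> (\<forall>x\<in>pverts G. \<exists>s\<in>S. x \<in> closed_nbhd G s)"
  using nbhd_in_verts
  by (fastforce simp: dominating_set_def closed_set_nbhd_def set_nbhd_def closed_nbhd_def)

lemma total_dominating_set_iff:
  "total_dominating_set G S \<longleftrightarrow> S \<subseteq> pverts G \<and> (\<forall>x\<in>pverts G. \<exists>s\<in>S. x \<in> nbhd G s)"
  using nbhd_in_verts by (fastforce simp: total_dominating_set_def set_nbhd_def)

lemma min_dominating_set:
  obtains S where "dominating_set G S" "card S = domination_number G"
proof -
  have "dominating_set G (pverts G)"
    unfolding dominating_set_iff by (auto intro: self_in_closed_nbhd)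
  then have "\<exists>k. \<exists>S. dominating_set G S \<and> card S = k" by blast
  from LeastI_ex[OF this] show ?thesis
    using that unfolding domination_number_def by blast
qed

lemma min_total_dominating_set:
  assumes "\<forall>v \<in> pverts G. \<not> isolated G v"
  obtains S where "total_dominating_set G S" "card S = total_domination_number G"
proof -
  have "total_dominating_set G (pverts G)"
    unfolding total_dominating_set_iff
    using assms nbhd_sym nbhd_in_verts unfolding isolated_def by blast
  then have "\<exists>k. \<exists>S. total_dominating_set G S \<and> card S = k" by blast
  from LeastI_ex[OF this] show ?thesis
    using that unfolding total_domination_number_def by blast
qed

text \<open>One neighbour added for each vertex of a minimum dominating set makes it total.\<close>

lemma total_domination_number_le_twice:
  assumes "\<forall>v \<in> pverts G. \<not> isolated G v"
  shows "total_domination_number G \<le> 2 * domination_number G"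
proof -
  obtain D where D: "dominating_set G D" "card D = domination_number G"
    by (rule min_dominating_set)
  have Dv: "D \<subseteq> pverts G" using D by (simp add: dominating_set_iff)
  then have fin: "finite D" using finite_subset pair_finite_verts by blast
  have "\<forall>v\<in>D. \<exists>u. u \<in> nbhd G v" using assms Dv unfolding isolated_def by blast
  then obtain f where f: "\<And>v. v \<in> D \<Longrightarrow> f v \<in> nbhd G v" by metis
  have "\<exists>s\<in>D \<union> f ` D. x \<in> nbhd G s" if x: "x \<in> pverts G" for x
  proof -
    obtain a where a: "a \<in> D" "x \<in> closed_nbhd G a"
      using x D(1) unfolding dominating_set_iff by blast
    then show ?thesis using f[of a] nbhd_sym unfolding closed_nbhd_def by blast
  qed
  then have "total_dominating_set G (D \<union> f ` D)"
    using Dv f nbhd_in_verts unfolding total_dominating_set_iff by blast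
  then have "total_domination_number G \<le> card (D \<union> f ` D)"
    by (rule total_domination_number_le)
  also have "\<dots> \<le> card D + card (f ` D)" by (rule card_Un_le)
  also have "\<dots> \<le> 2 * card D" using card_image_le[OF fin, of f] by simp
  finally show ?thesis using D by simp
qed

section \<open>Lower bounds by counting along a packing\<close>

text \<open>\<open>A\<close> meets the closed neighbourhoods of a packing in disjoint parts. Taking
  \<open>k = 1\<close> computes \<open>\<gamma>\<close>, and \<open>k = 2\<close> bounds
  \<open>\<gamma>\<^sub>t\<close> from below.\<close>

lemma packing_card_le:
  assumes "packing G S" "finite A"
    and "\<And>v. v \<in> S \<Longrightarrow> k \<le> card (A \<inter> closed_nbhd G v)"
  shows "k * card S \<le> card A"
proof -
  have fin: "finite S"
    using assms(1) finite_subset pair_finite_verts unfolding packing_def by blast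
  have "k * card S = (\<Sum>v\<in>S. k)" by simp
  also have "\<dots> \<le> (\<Sum>v\<in>S. card (A \<inter> closed_nbhd G v))"
    using assms(3) by (rule sum_mono)
  also have "\<dots> = card (\<Union>v\<in>S. A \<inter> closed_nbhd G v)"
    using assms(1,2) fin unfolding packing_def
    by (intro card_UN_disjoint[symmetric]) blast+
  also have "\<dots> \<le> card A" using assms(2) by (intro card_mono) auto
  finally show ?thesis .
qed

lemma packing_dominating_card:
  assumes "packing G S" "dominating_set G S"
  shows "domination_number G = card S"
proof (rule antisym)
  show "domination_number G \<le> card S" using assms(2) by (rule domination_number_le)
  obtain D where D: "dominating_set G D" "card D = domination_number G"
    by (rule min_dominating_set)
  have fin: "finite D" using D(1) finite_subset pair_finite_verts
    unfolding dominating_set_iff by blast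
  have "1 \<le> card (D \<inter> closed_nbhd G v)" if "v \<in> S" for v
  proof -
    have "D \<inter> closed_nbhd G v \<noteq> {}"
      using D(1) that assms(1) closed_nbhd_sym unfolding dominating_set_iff packing_def by blast
    then show ?thesis using fin by (simp add: Suc_le_eq card_gt_0_iff)
  qed
  from packing_card_le[OF assms(1) fin this] show "card S \<le> domination_number G"
    using D(2) by simp
qed

text \<open>If \<open>A\<close> met \<open>N[v]\<close> only in a vertex \<open>u\<close>, then
  \<open>u\<close> would be dominated from outside \<open>N[v]\<close> and so lie in
  \<open>M(v)\<close>, while \<open>D(v)\<close>, which can be dominated only from inside
  \<open>N[v]\<close>, would lie in \<open>N(u)\<close>. This is what \<open>special\<close>
  forbids.\<close>

lemma special_total_dominating:
  assumes "special G v" "total_dominating_set G A"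
  shows "2 \<le> card (A \<inter> closed_nbhd G v)"
proof (rule ccontr)
  assume "\<not> ?thesis"
  moreover have fin: "finite (A \<inter> closed_nbhd G v)"
    using assms(2) finite_subset pair_finite_verts unfolding total_dominating_set_iff by blast
  ultimately have small: "\<And>x y. x \<in> A \<Longrightarrow> x \<in> closed_nbhd G v \<Longrightarrow> y \<in> A \<Longrightarrow>
      y \<in> closed_nbhd G v \<Longrightarrow> x = y"
    using card_le_Suc0_iff_eq[OF fin] by (auto simp: not_le numeral_2_eq_2 less_Suc_eq_le)
  have dom: "\<exists>s\<in>A. x \<in> nbhd G s" if "x \<in> pverts G" for x
    using that assms(2) unfolding total_dominating_set_iff by blast
  have "v \<in> pverts G" using assms(1) by (simp add: special_def)
  then obtain u where u: "u \<in> A" "u \<in> nbhd G v" using dom nbhd_sym by blast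
  have uc: "u \<in> closed_nbhd G v" using u by (simp add: closed_nbhd_def)
  obtain w where w: "w \<in> A" "w \<in> nbhd G u"
    using dom[of u] u nbhd_in_verts nbhd_sym by blast
  have "w \<notin> closed_nbhd G v" using small[OF w(1) _ u(1) uc] w(2) nbhd_irrefl by blast
  then have "u \<in> M_set G v" using u w by (auto simp: M_set_def)
  moreover have "D_set G v \<subseteq> nbhd G u"
  proof
    fix d assume d: "d \<in> D_set G v"
    then obtain s where s: "s \<in> A" "d \<in> nbhd G s"
      using dom[of d] nbhd_in_verts unfolding D_set_def by blast
    have "s \<in> closed_nbhd G v" using s d nbhd_sym
      unfolding D_set_def closed_nbhd_def by blast
    then show "d \<in> nbhd G u" using small[OF s(1) _ u(1) uc] s(2) by blast
  qed
  ultimately show False using assms(1) unfolding special_def by blast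
qed

lemma total_domination_number_eq_twice:
  assumes noiso: "\<forall>v \<in> pverts G. \<not> isolated G v"
    and "S \<subseteq> special_vertices G" "packing G S" "dominating_set G S"
  shows "total_domination_number G = 2 * domination_number G"
proof (rule antisym)
  show "total_domination_number G \<le> 2 * domination_number G"
    by (rule total_domination_number_le_twice[OF noiso])
  obtain A where A: "total_dominating_set G A" "card A = total_domination_number G"
    by (rule min_total_dominating_set[OF noiso])
  have "finite A" using A(1) finite_subset pair_finite_verts
    unfolding total_dominating_set_iff by blast
  then have "2 * card S \<le> card A"
    using special_total_dominating[OF _ A(1)] assms(2)
    by (intro packing_card_le[OF assms(3)]) (auto simp: special_vertices_def)
  then show "2 * domination_number G \<le> total_domination_number G"
    using A(2) packing_dominating_card[OF assms(3,4)] by simp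
qed

section \<open>Minimum dominating sets as packings\<close>

text \<open>A common vertex \<open>w\<close> of \<open>N[u]\<close> and \<open>N[v]\<close> serves
  as partner for both, so \<open>D\<close> becomes total with at most \<open>|D| - 1\<close> added
  vertices.\<close>

lemma min_dominating_set_packing:
  assumes noiso: "\<forall>v \<in> pverts G. \<not> isolated G v"
    and eq: "total_domination_number G = 2 * domination_number G"
    and D: "dominating_set G D" "card D = domination_number G"
  shows "packing G D"
proof (rule ccontr)
  assume np: "\<not> packing G D"
  have Dv: "D \<subseteq> pverts G" using D by (simp add: dominating_set_iff)
  then have fin: "finite D" using finite_subset pair_finite_verts by blast
  obtain u v where uv: "u \<in> D" "v \<in> D" "u \<noteq> v" "closed_nbhd G u \<inter> closed_nbhd G v \<noteq> {}"
    using np Dv unfolding packing_def by blast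
  then obtain w where w: "w \<in> closed_nbhd G u" "w \<in> closed_nbhd G v" by blast
  have "\<forall>v\<in>D. \<exists>u. u \<in> nbhd G v" using noiso Dv unfolding isolated_def by blast
  then obtain f where f: "\<And>v. v \<in> D \<Longrightarrow> f v \<in> nbhd G v" by metis
  let ?A = "insert w D \<union> f ` (D - {u, v})"
  have cover: "\<exists>s\<in>?A. x \<in> nbhd G s" if x: "x \<in> pverts G" for x
  proof -
    have *: "\<exists>s\<in>?A. y \<in> nbhd G s" if "y \<in> D" for y
    proof (cases "y = u \<or> y = v")
      case True
      \<comment> \<open>If \<open>w\<close> is \<open>u\<close> or \<open>v\<close>, these two are
        adjacent and dominate each other; otherwise \<open>w\<close> is adjacent to both.\<close>
      then show ?thesis using w uv nbhd_sym unfolding closed_nbhd_def by blast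
    next
      case False
      then show ?thesis using f[OF that] nbhd_sym that by blast
    qed
    from x obtain s where "s \<in> D" "x \<in> closed_nbhd G s"
      using D(1) unfolding dominating_set_iff by blast
    then show ?thesis using * unfolding closed_nbhd_def by blast
  qed
  have "?A \<subseteq> pverts G" using Dv f w nbhd_in_verts uv unfolding closed_nbhd_def by blast
  then have "total_dominating_set G ?A"
    using cover unfolding total_dominating_set_iff by blast
  then have "total_domination_number G \<le> card ?A" by (rule total_domination_number_le)
  also have "\<dots> \<le> card (insert w D) + card (f ` (D - {u, v}))" by (rule card_Un_le)
  also have "\<dots> \<le> Suc (card D) + card (D - {u, v})"
    using card_image_le[of "D - {u, v}" f] card_insert_le_m1[of "Suc (card D)" D w] fin
    by (intro add_mono) auto
  also have "\<dots> < 2 * card D"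
  proof -
    \<comment> \<open>This keeps the subtraction of naturals below from truncating.\<close>
    have "card {u, v} \<le> card D" using uv fin by (intro card_mono) auto
    moreover have "card (D - {u, v}) = card D - card {u, v}"
      using uv by (intro card_Diff_subset) auto
    ultimately show ?thesis using uv by simp
  qed
  finally show False using eq D by simp
qed

section \<open>Short cycles in chordal graphs\<close>

lemma arc_iff_nbhd: "(u, v) \<in> parcs G \<longleftrightarrow> v \<in> nbhd G u"
  by (simp add: nbhd_def)

lemma chordal_no_C4:
  assumes "chordal G" "b \<in> nbhd G a" "c \<in> nbhd G b" "d \<in> nbhd G c" "a \<in> nbhd G d"
    and "c \<notin> nbhd G a" "d \<notin> nbhd G b" "distinct [a, b, c, d]"
  shows False
proof -
  have "\<not> induced_cycle G [a, b, c, d]"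
    using assms(1) unfolding chordal_def by (auto dest: spec[of _ "[a, b, c, d]"])
  moreover have "{a, b, c, d} \<subseteq> pverts G" using assms(2-5) nbhd_in_verts by blast
  \<comment> \<open>Edges and non-edges are assumed in one direction only;
    \<open>induced_cycle\<close> asks for both.\<close>
  moreover have "a \<in> nbhd G b" "b \<in> nbhd G c" "c \<in> nbhd G d" "d \<in> nbhd G a"
      "a \<notin> nbhd G c" "b \<notin> nbhd G d"
    using assms(2-7) nbhd_sym by blast+
  ultimately show False
    using assms(2-8) unfolding induced_cycle_def by (simp add: All_less_Suc arc_iff_nbhd)
qed

lemma chordal_no_C5:
  assumes "chordal G" "b \<in> nbhd G a" "c \<in> nbhd G b" "d \<in> nbhd G c" "e \<in> nbhd G d" "a \<in> nbhd G e"
    and "c \<notin> nbhd G a" "d \<notin> nbhd G a" "d \<notin> nbhd G b" "e \<notin> nbhd G b" "e \<notin> nbhd G c"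
    and "distinct [a, b, c, d, e]"
  shows False
proof -
  have "\<not> induced_cycle G [a, b, c, d, e]"
    using assms(1) unfolding chordal_def by (auto dest: spec[of _ "[a, b, c, d, e]"])
  moreover have "{a, b, c, d, e} \<subseteq> pverts G" using assms(2-6) nbhd_in_verts by blast
  moreover have "a \<in> nbhd G b" "b \<in> nbhd G c" "c \<in> nbhd G d" "d \<in> nbhd G e" "e \<in> nbhd G a"
      "a \<notin> nbhd G c" "a \<notin> nbhd G d" "b \<notin> nbhd G d" "b \<notin> nbhd G e" "c \<notin> nbhd G e"
    using assms(2-11) nbhd_sym by blast+
  ultimately show False
    using assms(2-12) unfolding induced_cycle_def by (simp add: All_less_Suc arc_iff_nbhd)
qed

lemma chordal_no_C6:
  assumes "chordal G" "b \<in> nbhd G a" "c \<in> nbhd G b" "d \<in> nbhd G c" "e \<in> nbhd G d" "f \<in> nbhd G e"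
      "a \<in> nbhd G f"
    and "c \<notin> nbhd G a" "d \<notin> nbhd G a" "e \<notin> nbhd G a" "d \<notin> nbhd G b" "e \<notin> nbhd G b"
      "f \<notin> nbhd G b" "e \<notin> nbhd G c" "f \<notin> nbhd G c" "f \<notin> nbhd G d"
    and "distinct [a, b, c, d, e, f]"
  shows False
proof -
  have "\<not> induced_cycle G [a, b, c, d, e, f]"
    using assms(1) unfolding chordal_def by (auto dest: spec[of _ "[a, b, c, d, e, f]"])
  moreover have "{a, b, c, d, e, f} \<subseteq> pverts G" using assms(2-7) nbhd_in_verts by blast
  moreover have "a \<in> nbhd G b" "b \<in> nbhd G c" "c \<in> nbhd G d" "d \<in> nbhd G e" "e \<in> nbhd G f"
      "f \<in> nbhd G a" "a \<notin> nbhd G c" "a \<notin> nbhd G d" "a \<notin> nbhd G e" "b \<notin> nbhd G d"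
      "b \<notin> nbhd G e" "b \<notin> nbhd G f" "c \<notin> nbhd G e" "c \<notin> nbhd G f" "d \<notin> nbhd G f"
    using assms(2-16) nbhd_sym by blast+
  ultimately show False
    using assms(2-17) unfolding induced_cycle_def by (simp add: All_less_Suc arc_iff_nbhd)
qed

text \<open>A neighbour \<open>p\<close> of \<open>a\<close> with the most neighbours in \<open>N(v)\<close> works: if it missed \<open>x\<close>, then
  by maximality some \<open>z \<in> N(p) \<inter> N(v)\<close> would not be adjacent to \<open>y\<close>, and the closed walk
  \<open>v, x, y, a, p, z\<close>, cut short by \<open>xz\<close> or \<open>yp\<close> when these are edges, would be an induced
  cycle.\<close>
lemma chordal_common_neighbour:
  assumes ch: "chordal G" and "nbhd G a \<noteq> {}"
    and disj: "closed_nbhd G v \<inter> closed_nbhd G a = {}"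
  obtains p where "p \<in> nbhd G a"
    and "\<And>x y. x \<in> nbhd G v \<Longrightarrow> y \<in> nbhd G a \<Longrightarrow> y \<in> nbhd G x \<Longrightarrow> p \<in> nbhd G x"
proof -
  define h where "h p = card (nbhd G p \<inter> nbhd G v)" for p
  have "Max (h ` nbhd G a) \<in> h ` nbhd G a"
    using assms(2) finite_nbhd by (intro Max_in) auto
  then obtain p where p: "p \<in> nbhd G a" "h p = Max (h ` nbhd G a)" by auto
  have hmax: "h y \<le> h p" if "y \<in> nbhd G a" for y
    using that p(2) finite_nbhd by simp
  have "p \<in> nbhd G x" if x: "x \<in> nbhd G v" and y: "y \<in> nbhd G a" "y \<in> nbhd G x" for x y
  proof (rule ccontr)
    assume px: "p \<notin> nbhd G x"
    have xy: "x \<in> nbhd G y" "x \<notin> nbhd G p" using y px nbhd_sym by blast+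
    \<comment> \<open>\<open>x\<close> lies in \<open>N(y)\<close> but not in \<open>N(p)\<close>,
      so the inclusion would be strict and \<open>y\<close> would beat \<open>p\<close>.\<close>
    have "\<not> nbhd G p \<inter> nbhd G v \<subseteq> nbhd G y \<inter> nbhd G v"
    proof
      assume "nbhd G p \<inter> nbhd G v \<subseteq> nbhd G y \<inter> nbhd G v"
      with xy x have "nbhd G p \<inter> nbhd G v \<subset> nbhd G y \<inter> nbhd G v" by blast
      then have "h p < h y" unfolding h_def using finite_nbhd by (intro psubset_card_mono) auto
      then show False using hmax[OF y(1)] by simp
    qed
    then obtain z where z: "z \<in> nbhd G p" "z \<in> nbhd G v" "z \<notin> nbhd G y" by blast
    \<comment> \<open>Disjointness of \<open>N[v]\<close> and \<open>N[a]\<close> excludes all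
      chords but \<open>xp\<close>, \<open>yz\<close>, \<open>xz\<close> and \<open>yp\<close>; the
      first two are absent by \<open>px\<close> and by the choice of \<open>z\<close>.\<close>
    have dv: "v \<noteq> a" "v \<notin> nbhd G a" "a \<notin> nbhd G v"
      and dx: "x \<noteq> a" "x \<notin> nbhd G a" "z \<noteq> a" "z \<notin> nbhd G a"
      and dy: "y \<noteq> v" "y \<notin> nbhd G v" "p \<noteq> v" "p \<notin> nbhd G v"
      using disj x z y p nbhd_sym unfolding closed_nbhd_def by blast+
    have adj: "v \<in> nbhd G x" "v \<in> nbhd G z" "p \<in> nbhd G z" "a \<in> nbhd G y" "a \<in> nbhd G p"
      using x y z p nbhd_sym by blast+
    have non: "a \<notin> nbhd G x" "a \<notin> nbhd G z" "v \<notin> nbhd G y" "v \<notin> nbhd G p" "y \<notin> nbhd G z"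
      using dv dx dy z nbhd_sym by blast+
    \<comment> \<open>The reversed list gives \<open>simp\<close> each inequality in the other
      direction.\<close>
    have dist: "distinct [v, x, y, a, p, z]" "distinct [z, p, a, y, x, v]"
      using dv dx dy x y z p xy nbhd_irrefl by auto
    show False
    \<comment> \<open>In the cycle lemmas \<open>b\<close> occurs before \<open>a\<close>, so the
      first two arguments are swapped. The cycles are \<open>x, y, p, z\<close>, then
      \<open>a, y, x, z, p\<close>, then \<open>x, v, z, p, y\<close>, then
      \<open>x, v, z, p, a, y\<close>.\<close>
    proof (cases "x \<in> nbhd G z"; cases "p \<in> nbhd G y")
      assume "x \<in> nbhd G z" "p \<in> nbhd G y"
      then show False
        using y z px dist by (intro chordal_no_C4[OF ch, of y x p z]) simp_all
    next
      assume "x \<in> nbhd G z" "p \<notin> nbhd G y"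
      then have "z \<in> nbhd G x" using nbhd_sym by blast
      then show False
        using \<open>p \<notin> nbhd G y\<close> chordal_no_C5[OF ch, of y a x z p] dx adj y z xy px dist
        by simp
    next
      assume "x \<notin> nbhd G z" "p \<in> nbhd G y"
      then have "z \<notin> nbhd G x" "y \<in> nbhd G p" using nbhd_sym by blast+
      then show False
        using chordal_no_C5[OF ch, of v x z p y] dy adj non xy z px dist by simp
    next
      assume "x \<notin> nbhd G z" "p \<notin> nbhd G y"
      then have "z \<notin> nbhd G x" "y \<notin> nbhd G p" using nbhd_sym by blast+
      then show False
        using chordal_no_C6[OF ch, of v x z p a y] dv dy adj non xy y z px dist by simp
    qed
  qed
  with p(1) show ?thesis by (rule that)
qed

section \<open>Special vertices and minimum dominating sets\<close>

text \<open>In the new set, \<open>u\<close> covers \<open>v\<close>, \<open>D(v)\<close> and the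
  true twins of \<open>v\<close>, while the vertices \<open>p a\<close> cover \<open>M(v)\<close>,
  including \<open>u\<close>. Since \<open>u\<close> alone stands for \<open>v\<close> and its
  partner, at most \<open>2|D| - 1\<close> vertices are used.\<close>

lemma min_dominating_set_special:
  assumes noiso: "\<forall>v \<in> pverts G. \<not> isolated G v" and ch: "chordal G"
    and eq: "total_domination_number G = 2 * domination_number G"
    and D: "dominating_set G D" "card D = domination_number G" and v: "v \<in> D"
  shows "special G v"
proof (rule ccontr)
  assume "\<not> special G v"
  have pack: "packing G D" using noiso eq D by (rule min_dominating_set_packing)
  have Dv: "D \<subseteq> pverts G" using D by (simp add: dominating_set_iff)
  then have fin: "finite D" using finite_subset pair_finite_verts by blast
  obtain u where u: "u \<in> M_set G v" "D_set G v \<subseteq> nbhd G u"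
    using \<open>\<not> special G v\<close> v Dv noiso unfolding special_def by blast
  have uv: "u \<in> nbhd G v" "v \<in> nbhd G u" using u nbhd_sym unfolding M_set_def by blast+
  have "\<exists>p. p \<in> nbhd G a \<and>
      (\<forall>x y. x \<in> nbhd G v \<longrightarrow> y \<in> nbhd G a \<longrightarrow> y \<in> nbhd G x \<longrightarrow> p \<in> nbhd G x)"
    if "a \<in> D - {v}" for a
  proof -
    have "nbhd G a \<noteq> {}" using that Dv noiso unfolding isolated_def by blast
    moreover have "closed_nbhd G v \<inter> closed_nbhd G a = {}"
      using that v pack unfolding packing_def by blast
    ultimately show ?thesis by (rule chordal_common_neighbour[OF ch]) blast
  qed
  then obtain p where p: "\<And>a. a \<in> D - {v} \<Longrightarrow> p a \<in> nbhd G a"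
    and px: "\<And>a x y. a \<in> D - {v} \<Longrightarrow> x \<in> nbhd G v \<Longrightarrow> y \<in> nbhd G a \<Longrightarrow> y \<in> nbhd G x \<Longrightarrow>
      p a \<in> nbhd G x"
    by metis
  let ?A = "insert u (D - {v}) \<union> p ` (D - {v})"
  have M: "\<exists>s\<in>?A. x \<in> nbhd G s" if x: "x \<in> M_set G v" for x
  proof -
    obtain w where w: "x \<in> nbhd G v" "w \<in> nbhd G x" "w \<notin> closed_nbhd G v"
      using x unfolding M_set_def by blast
    obtain a where a: "a \<in> D" "w \<in> closed_nbhd G a"
      using D(1) nbhd_in_verts[OF w(2)] unfolding dominating_set_iff by blast
    have av: "a \<in> D - {v}" using a w by auto
    \<comment> \<open>\<open>px\<close> needs \<open>w\<close> to be a proper neighbour of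
      \<open>a\<close>; the packing property ensures this.\<close>
    have "w \<noteq> a"
    proof
      assume "w = a"
      then have "x \<in> closed_nbhd G v \<inter> closed_nbhd G a"
        using w nbhd_sym unfolding closed_nbhd_def by blast
      then show False using pack v av unfolding packing_def by blast
    qed
    then have "p a \<in> nbhd G x" using px[OF av w(1) _ w(2)] a by (simp add: closed_nbhd_def)
    then show ?thesis using av nbhd_sym by blast
  qed
  have cover: "\<exists>s\<in>?A. x \<in> nbhd G s" if x: "x \<in> pverts G" for x
  proof -
    from x obtain a where a: "a \<in> D" "x \<in> closed_nbhd G a"
      using D(1) unfolding dominating_set_iff by blast
    consider "a \<noteq> v" "x \<in> nbhd G a" | "a \<noteq> v" "x = a" | "x = v" | "x \<in> M_set G v"
      | "x \<in> D_set G v" | "x \<in> nbhd G v" "closed_nbhd G x = closed_nbhd G v"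
      using a unfolding closed_nbhd_def M_set_def D_set_def by blast
    then show ?thesis
    proof cases
      case 1
      then show ?thesis using a by blast
    next
      case 2
      then show ?thesis using a p[of a] nbhd_sym by blast
    next
      case 3
      then show ?thesis using uv by blast
    next
      case 4
      then show ?thesis by (rule M)
    next
      case 5
      then show ?thesis using u by blast
    next
      case 6
      then have "x = u \<or> u \<in> nbhd G x" using uv unfolding closed_nbhd_def by blast
      then show ?thesis using M[OF u(1)] nbhd_sym by blast
    qed
  qed
  have "?A \<subseteq> pverts G" using Dv p uv nbhd_in_verts by blast
  then have "total_dominating_set G ?A"
    using cover unfolding total_dominating_set_iff by blast
  then have "total_domination_number G \<le> card ?A" by (rule total_domination_number_le)
  also have "\<dots> \<le> card (insert u (D - {v})) + card (p ` (D - {v}))" by (rule card_Un_le)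
  also have "\<dots> \<le> Suc (card (D - {v})) + card (D - {v})"
    using card_image_le[of "D - {v}" p] fin by (intro add_mono) (auto simp: card_insert_if)
  also have "\<dots> < 2 * card D"
    using card_Diff_singleton[OF v] v fin card_gt_0_iff[of D] by auto
  finally show False using eq D by simp
qed

text \<open>Let \<open>v\<close> in \<open>D\<close> dominate \<open>s\<close>. If their closed
  neighbourhoods are incomparable, then \<open>v\<close> is in \<open>M(s)\<close>, so some
  \<open>d\<close> in \<open>D(s)\<close> is not adjacent to \<open>v\<close>. The vertex of
  \<open>D\<close> dominating \<open>d\<close> also has \<open>s\<close> in its closed
  neighbourhood, against the packing property.\<close>

lemma special_true_twin:
  assumes pack: "packing G D" and dom: "dominating_set G D"
    and spec: "\<And>v. v \<in> D \<Longrightarrow> special G v" and s: "special G s"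
  obtains v where "v \<in> D" "closed_nbhd G s = closed_nbhd G v"
proof -
  have "s \<in> pverts G" using s by (simp add: special_def)
  then obtain v where v: "v \<in> D" "s \<in> closed_nbhd G v"
    using dom unfolding dominating_set_iff by blast
  have "closed_nbhd G s = closed_nbhd G v"
  proof (rule ccontr)
    assume ne: "closed_nbhd G s \<noteq> closed_nbhd G v"
    then have sv: "s \<in> nbhd G v" "v \<in> nbhd G s"
      using v nbhd_sym unfolding closed_nbhd_def by blast+
    \<comment> \<open>Here \<open>y\<close> itself is the witness in \<open>M(x)\<close>: all of
      \<open>D(x)\<close> lies in \<open>N[y]\<close>, and \<open>y\<close> is not in
      \<open>D(x)\<close>.\<close>
    have not_special: "\<not> special G x"
      if "x \<in> nbhd G y" "closed_nbhd G x \<subset> closed_nbhd G y" for x y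
    proof -
      have yx: "y \<in> nbhd G x" using that nbhd_sym by blast
      have "y \<in> M_set G x" using that yx unfolding M_set_def closed_nbhd_def by blast
      moreover have "D_set G x \<subseteq> nbhd G y"
        using that unfolding D_set_def closed_nbhd_def by blast
      ultimately show ?thesis unfolding special_def by blast
    qed
    have "\<not> closed_nbhd G s \<subset> closed_nbhd G v" "\<not> closed_nbhd G v \<subset> closed_nbhd G s"
      using not_special sv s spec[OF v(1)] by blast+
    then have "v \<in> M_set G s" using ne sv unfolding M_set_def closed_nbhd_def by blast
    then obtain d where d: "d \<in> D_set G s" "d \<notin> nbhd G v"
      using s unfolding special_def by blast
    have ds: "d \<in> nbhd G s" "closed_nbhd G d \<subset> closed_nbhd G s"
      using d(1) unfolding D_set_def by auto
    have "d \<noteq> v" using ds \<open>\<not> closed_nbhd G v \<subset> closed_nbhd G s\<close> by blast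
    obtain a where a: "a \<in> D" "d \<in> closed_nbhd G a"
      using dom nbhd_in_verts[OF ds(1)] unfolding dominating_set_iff by blast
    have "a \<noteq> v" using a d \<open>d \<noteq> v\<close> unfolding closed_nbhd_def by blast
    moreover have "s \<in> closed_nbhd G a" using a ds closed_nbhd_sym by blast
    ultimately show False using pack a v unfolding packing_def by blast
  qed
  with v(1) show ?thesis by (rule that)
qed

end

section \<open>The equivalence for transversals of the twin classes\<close>

theorem corollary2p2:
  fixes G :: "'a pair_pre_digraph" and S :: "'a set"
  assumes "pair_graph G"
    and "pverts G \<noteq> {}"
    and "chordal G"
    and "\<forall>v \<in> pverts G. \<not> isolated G v"
    and "S_set G S"
  shows "total_domination_number G = 2 * domination_number G \<longleftrightarrow>
    packing G S \<and> dominating_set G S"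
proof -
  interpret pair_graph G by fact
  have S: "S \<subseteq> special_vertices G"
    and trans: "\<And>C. C \<in> special_vertices G // special_twin_rel G \<Longrightarrow> \<exists>!v. v \<in> S \<inter> C"
    using assms(5) unfolding S_set_def by blast+
  show ?thesis
  proof
    assume "packing G S \<and> dominating_set G S"
    then show "total_domination_number G = 2 * domination_number G"
      using total_domination_number_eq_twice[OF assms(4) S] by blast
  next
    assume eq: "total_domination_number G = 2 * domination_number G"
    obtain D where D: "dominating_set G D" "card D = domination_number G"
      by (rule min_dominating_set)
    have pack: "packing G D" using assms(4) eq D by (rule min_dominating_set_packing)
    have spec: "special G v" if "v \<in> D" for v
      using assms(4,3) eq D that by (rule min_dominating_set_special)
    have twin: "\<exists>v\<in>D. closed_nbhd G s = closed_nbhd G v" if "s \<in> S" for s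
    proof -
      have "special G s" using that S unfolding special_vertices_def by blast
      from special_true_twin[OF pack D(1) spec this] show ?thesis by blast
    qed
    \<comment> \<open>Transversality, restated without the quotient: \<open>S\<close> has exactly
      one true twin of \<open>v\<close>.\<close>
    have repr: "\<exists>!s. s \<in> S \<and> closed_nbhd G s = closed_nbhd G v" if "special G v" for v
    proof -
      have "special_twin_rel G `` {v} \<in> special_vertices G // special_twin_rel G"
        using that by (auto simp: special_vertices_def intro: quotientI)
      from trans[OF this] have "\<exists>!s. s \<in> S \<inter> special_twin_rel G `` {v}" .
      moreover have "s \<in> S \<inter> special_twin_rel G `` {v} \<longleftrightarrow>
          s \<in> S \<and> closed_nbhd G s = closed_nbhd G v" for s
        using that S by (auto simp: special_twin_rel_def special_vertices_def true_twins_def)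
      ultimately show ?thesis by (simp only:)
    qed
    have "S \<subseteq> pverts G" using S by (auto simp: special_vertices_def special_def)
    \<comment> \<open>The vertex of \<open>D\<close> dominating \<open>x\<close> is replaced by its
      twin in \<open>S\<close>.\<close>
    moreover have "\<exists>s\<in>S. x \<in> closed_nbhd G s" if "x \<in> pverts G" for x
      using that D(1) repr[OF spec] unfolding dominating_set_iff by metis
    moreover have "closed_nbhd G s \<inter> closed_nbhd G t = {}" if st: "s \<in> S" "t \<in> S" "s \<noteq> t" for s t
    proof -
      obtain v w where vw: "v \<in> D" "w \<in> D" "closed_nbhd G s = closed_nbhd G v"
          "closed_nbhd G t = closed_nbhd G w"
        using twin[OF st(1)] twin[OF st(2)] by blast
      \<comment> \<open>Otherwise \<open>s\<close> and \<open>t\<close> would be two representatives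
        of one twin class.\<close>
      then have "v \<noteq> w" using repr[OF spec[OF vw(1)]] st by metis
      then show ?thesis using vw pack unfolding packing_def by simp
    qed
    ultimately show "packing G S \<and> dominating_set G S"
      unfolding packing_def dominating_set_iff by blast
  qed
qed

end
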